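(* Let $C$ be the Cantor fan. (1) There is a continuous mapping $f:C\to C$, which is not a homeomorphism, such that $(C,f)$ is mixing as well as chaotic in the sense of Devaney. (2) There is a homeomorphism $h:C\to C$ such that $(C,h)$ is mixing as well as chaotic in the sense of Devaney.
   Context: The Cantor fan is (up to homeomorphism) the continuum $\bigcup_{c\in K}S_c$ in the plane, where $K\subseteq[0,1]$ is the standard Cantor set and $S_c$ is the straight line segment from $(0,0)$ to $(c,1)$. A dynamical system $(X,f)$ is a non-empty compact metric space $X$ with a continuous $f:X\to X$. It is transitive if for all non-empty open sets $U,V$ in $X$ there is a non-negative integer $n$ with $f^n(U)\cap V\neq\emptyset$. It is mixing if for all non-empty open sets $U,V$ in $X$ there is a non-negative integer $n_0$ such that $f^n(U)\cap V\neq\emptyset$ for each positive integer $n\geq n_0$. A point $p\in X$ is periodic if $f^n(p)=p$ for some positive integer $n$; $\mathcal P(f)$ is the set of periodic points. $(X,f)$ is chaotic in the sense of Devaney if it is transitive and $\mathcal P(f)$ is dense in $X$. *)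

theory Defs
  imports "HOL-Analysis.Analysis"
begin

primrec cantor_stage :: "nat \<Rightarrow> real set" where
  "cantor_stage 0 = {0..1}"
| "cantor_stage (Suc n) =
     (\<lambda>x. x / 3) ` cantor_stage n \<union> (\<lambda>x. (x + 2) / 3) ` cantor_stage n"

definition cantor_set :: "real set" where
  "cantor_set = (\<Inter>n. cantor_stage n)"

definition standard_cantor_fan :: "(real \<times> real) set" where
  "standard_cantor_fan = (\<Union>c\<in>cantor_set. closed_segment (0, 0) (c, 1))"

definition cantor_fan :: "'a::metric_space set \<Rightarrow> bool" where
  "cantor_fan C \<longleftrightarrow> C homeomorphic standard_cantor_fan"

(* A self-map of the space X is a total function on the ambient type of which only the values
   on X matter; below, "open in X" refers to the subspace topology of X. *)

definition dynamical_system :: "'a::metric_space set \<Rightarrow> ('a \<Rightarrow> 'a) \<Rightarrow> bool" where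
  "dynamical_system X f \<longleftrightarrow> X \<noteq> {} \<and> compact X \<and> continuous_on X f \<and> f \<in> X \<rightarrow> X"

definition transitive_on :: "'a::metric_space set \<Rightarrow> ('a \<Rightarrow> 'a) \<Rightarrow> bool" where
  "transitive_on X f \<longleftrightarrow>
     (\<forall>U V. openin (top_of_set X) U \<and> U \<noteq> {} \<and> openin (top_of_set X) V \<and> V \<noteq> {} \<longrightarrow>
        (\<exists>n. (f ^^ n) ` U \<inter> V \<noteq> {}))"

definition mixing_on :: "'a::metric_space set \<Rightarrow> ('a \<Rightarrow> 'a) \<Rightarrow> bool" where
  "mixing_on X f \<longleftrightarrow>
     (\<forall>U V. openin (top_of_set X) U \<and> U \<noteq> {} \<and> openin (top_of_set X) V \<and> V \<noteq> {} \<longrightarrow>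
        (\<exists>n0. \<forall>n>0. n \<ge> n0 \<longrightarrow> (f ^^ n) ` U \<inter> V \<noteq> {}))"

definition periodic_points :: "'a::metric_space set \<Rightarrow> ('a \<Rightarrow> 'a) \<Rightarrow> 'a set" where
  "periodic_points X f = {p \<in> X. \<exists>n>0. (f ^^ n) p = p}"

definition devaney_chaotic_on :: "'a::metric_space set \<Rightarrow> ('a \<Rightarrow> 'a) \<Rightarrow> bool" where
  "devaney_chaotic_on X f \<longleftrightarrow> transitive_on X f \<and> X \<subseteq> closure (periodic_points X f)"

end

theory Submission
  imports Defs
begin

text \<open>
  The Cantor fan is the cone over the Cantor set, that is, the quotient of \<open>K \<times> [0,1]\<close> that
  collapses \<open>K \<times> {0}\<close> to the vertex. Any space of binary sequences over a countably infinite index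
  set is a copy of \<open>K\<close>. With the index set \<open>\<int> \<times> \<nat>\<close> a point of \<open>K\<close> becomes a bi-infinite word
  whose letters are themselves binary sequences, and the shift acts on these words. The theorem is
  proved by letting the words drive a motion along the blades of the fan.

  Each letter \<open>a\<close> carries a real number \<open>drift \<in> [-1,1]\<close>, and every number in \<open>[-1,1]\<close> is the drift
  of some letter. The skew product \<open>skew\<close> shifts the word and moves the height \<open>t\<close> to
  \<open>t powr exp v\<close>, where \<open>v\<close> is the drift of the letter at position \<open>0\<close>. The maps
  \<open>t \<mapsto> t powr exp v\<close> form an action of the additive group of reals on \<open>[0,1]\<close> which fixes \<open>0\<close> and
  \<open>1\<close> and is simply transitive on \<open>(0,1)\<close>, so that after \<open>n\<close> steps only the sum of the first \<open>n\<close>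
  drifts matters.

  Mixing (\<open>skew_mixing\<close>): a word that begins in one cylinder and must lie in another one \<open>n\<close> steps
  later has a free gap whose length grows with \<open>n\<close>. Because drifts fill an interval around \<open>0\<close>, one
  and the same letter repeated along a long gap gives the total drift any prescribed value
  (\<open>config_with_prescribed_drift\<close>), so the height can be sent exactly where it should go.

  Periodic points (\<open>skew_dense_periodic\<close>): complementing all bits of a letter negates its drift. Any
  finite word followed by its complement and then repeated periodically has total drift \<open>0\<close> over a
  period, hence gives a periodic point at every height.

  Both properties pass to factors (\<open>chaos_passes_to_factor\<close>). Reading all letters of a word off as one
  point of \<open>K\<close> makes the fan a factor on which the inverse of the skew product is defined as well:
  this is the homeomorphism. Reading off only the letters at positions \<open>i \<ge> 0\<close> makes the fan a
  factor on which the letter at position \<open>0\<close> is forgotten by the shift: at height \<open>1\<close>, which no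
  drift changes, two points with the same image result.
\<close>

section \<open>Digit expansions and the Cantor set\<close>

definition digit_series :: "real \<Rightarrow> (nat \<Rightarrow> bool) \<Rightarrow> real" where
  "digit_series r b = (\<Sum>k. of_bool (b k) * r ^ k)"

lemma summable_digits:
  fixes r :: real
  assumes "0 \<le> r" "r < 1"
  shows "summable (\<lambda>k. of_bool (b k) * r ^ k)"
  by (rule summable_comparison_test'[where g = "\<lambda>k. r ^ k" and N = 0])
     (use assms in \<open>auto intro!: summable_geometric\<close>)

lemma digit_series_bounds:
  assumes "0 \<le> r" "r < 1"
  shows "0 \<le> digit_series r b" "digit_series r b \<le> 1 / (1 - r)"
proof -
  show "0 \<le> digit_series r b"
    unfolding digit_series_def using assms by (intro suminf_nonneg summable_digits) auto
  have "digit_series r b \<le> (\<Sum>k. r ^ k)"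
    unfolding digit_series_def using assms
    by (intro suminf_le summable_digits) (auto intro!: summable_geometric)
  then show "digit_series r b \<le> 1 / (1 - r)"
    using assms by (simp add: suminf_geometric)
qed

lemma digit_series_unfold:
  assumes "0 \<le> r" "r < 1"
  shows "digit_series r b = of_bool (b 0) + r * digit_series r (\<lambda>k. b (Suc k))"
proof -
  have "(\<Sum>k. of_bool (b (Suc k)) * r ^ Suc k) = r * digit_series r (\<lambda>k. b (Suc k))"
    unfolding digit_series_def
    by (subst suminf_mult[OF summable_digits[OF assms], symmetric]) (simp add: mult_ac)
  then show ?thesis
    using suminf_split_head[OF summable_digits[OF assms, of b]]
    by (simp add: digit_series_def)
qed

lemma digit_series_complement:
  assumes "0 \<le> r" "r < 1"
  shows "digit_series r (\<lambda>k. \<not> b k) = 1 / (1 - r) - digit_series r b"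
proof -
  have "digit_series r (\<lambda>k. \<not> b k) + digit_series r b
      = (\<Sum>k. of_bool (\<not> b k) * r ^ k + of_bool (b k) * r ^ k)"
    unfolding digit_series_def by (intro suminf_add summable_digits assms)
  also have "\<dots> = (\<Sum>k. r ^ k)"
    by (intro suminf_cong) auto
  finally show ?thesis
    using assms by (simp add: suminf_geometric)
qed

text \<open>If a bounded set \<open>X\<close> is covered by its images under the two contractions \<open>y \<mapsto> d + r y\<close>, then
  following a point backwards through these contractions reads off an expansion of it. This yields
  the binary expansions (\<open>X = [0,2]\<close>) as well as the ternary ones of the Cantor set.\<close>

lemma digit_expansion_exists:
  assumes r: "0 < r" "r < 1" and bounded: "\<And>y. y \<in> X \<Longrightarrow> \<bar>y\<bar> \<le> M"
    and digit: "\<And>y. y \<in> X \<Longrightarrow> \<exists>d. (y - of_bool d) / r \<in> X" and x: "x \<in> X"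
  obtains b where "digit_series r b = x"
proof -
  obtain d where d: "\<And>y. y \<in> X \<Longrightarrow> (y - of_bool (d y)) / r \<in> X"
    using digit by metis
  define y where "y = rec_nat x (\<lambda>_ z. (z - of_bool (d z)) / r)"
  define b where "b = (\<lambda>k. d (y k))"
  have y_Suc: "y (Suc k) = (y k - of_bool (b k)) / r" and y_0: "y 0 = x" for k
    by (auto simp: y_def b_def)
  have yX: "y k \<in> X" for k
    by (induction k) (use x d in \<open>auto simp: y_0 y_Suc b_def\<close>)
  have partial: "x = (\<Sum>k<n. of_bool (b k) * r ^ k) + y n * r ^ n" for n
    by (induction n) (use r in \<open>auto simp: y_0 y_Suc field_simps\<close>)
  have "(\<lambda>n. M * r ^ n) \<longlonglongrightarrow> M * 0"
    using r by (intro tendsto_mult tendsto_const LIMSEQ_realpow_zero) auto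
  then have "(\<lambda>n. y n * r ^ n) \<longlonglongrightarrow> 0"
    using bounded[OF yX] r
    by (intro Lim_null_comparison[of "\<lambda>n. y n * r ^ n" "\<lambda>n. M * r ^ n"])
       (auto simp: abs_mult intro!: always_eventually mult_right_mono)
  then have "(\<lambda>n. x - y n * r ^ n) \<longlonglongrightarrow> x - 0"
    by (intro tendsto_diff tendsto_const)
  moreover have "(\<lambda>n. x - y n * r ^ n) = (\<lambda>n. \<Sum>k<n. of_bool (b k) * r ^ k)"
    using partial by (auto simp: fun_eq_iff algebra_simps)
  ultimately have "(\<lambda>k. of_bool (b k) * r ^ k) sums x"
    by (simp add: sums_def)
  then show ?thesis
    using that[of b] by (simp add: digit_series_def sums_iff)
qed

text \<open>For \<open>r = 1/3\<close> a leading digit 1 gives at least \<open>1\<close> and a leading digit 0 at most \<open>1/2\<close>, so the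
  digits can be recovered.\<close>

lemma digit_series_third_inj:
  assumes "digit_series (1/3) b = digit_series (1/3) c"
  shows "b = c"
proof
  fix k
  from assms show "b k = c k"
  proof (induction k arbitrary: b c)
    case 0
    then show ?case
      using digit_series_unfold[of "1/3" b] digit_series_unfold[of "1/3" c]
        digit_series_bounds[of "1/3" "\<lambda>k. b (Suc k)"] digit_series_bounds[of "1/3" "\<lambda>k. c (Suc k)"]
      by (cases "b 0"; cases "c 0") auto
  next
    case (Suc k)
    have "b 0 = c 0"
      using Suc.prems digit_series_unfold[of "1/3" b] digit_series_unfold[of "1/3" c]
        digit_series_bounds[of "1/3" "\<lambda>k. b (Suc k)"] digit_series_bounds[of "1/3" "\<lambda>k. c (Suc k)"]
      by (cases "b 0"; cases "c 0") auto
    then have "digit_series (1/3) (\<lambda>k. b (Suc k)) = digit_series (1/3) (\<lambda>k. c (Suc k))"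
      using Suc.prems digit_series_unfold[of "1/3" b] digit_series_unfold[of "1/3" c] by auto
    from Suc.IH[OF this] show ?case .
  qed
qed

lemma digit_series_half_surj:
  assumes "0 \<le> x" "x \<le> 2"
  obtains b where "digit_series (1/2) b = x"
proof (rule digit_expansion_exists[where X = "{0..2}" and r = "1/2" and M = 2])
  fix y :: real assume "y \<in> {0..2}"
  then show "\<exists>d. (y - of_bool d) / (1/2) \<in> {0..2}"
    by (intro exI[of _ "y \<ge> 1"]) auto
qed (use assms in auto)

lemma cantor_stage_bounds: "cantor_stage n \<subseteq> {0..1}"
  by (induction n) fastforce+

lemma cantor_set_digit:
  assumes "x \<in> cantor_set"
  obtains d where "3 * x - 2 * of_bool d \<in> cantor_set"
proof
  show "3 * x - 2 * of_bool (x > 1/2) \<in> cantor_set"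
    unfolding cantor_set_def
  proof
    fix n
    \<comment> \<open>The digit must not depend on the stage; the threshold \<open>1/2\<close> lies in the gap
      \<open>(1/3, 2/3)\<close> of every stage but the initial one.\<close>
    have "x \<in> cantor_stage (Suc n)"
      using assms unfolding cantor_set_def by blast
    then obtain y where y: "y \<in> cantor_stage n" "x = y / 3 \<or> x = (y + 2) / 3"
      by auto
    moreover have "0 \<le> y" "y \<le> 1"
      using y(1) cantor_stage_bounds by force+
    ultimately have "3 * x - 2 * of_bool (x > 1/2) = y"
      by auto
    then show "3 * x - 2 * of_bool (x > 1/2) \<in> cantor_stage n"
      using y(1) by simp
  qed
qed

definition cantor_point :: "(nat \<Rightarrow> bool) \<Rightarrow> real" where
  "cantor_point b = 2/3 * digit_series (1/3) b"

lemma cantor_point_in: "cantor_point b \<in> cantor_set"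
  unfolding cantor_set_def
proof
  fix n
  show "cantor_point b \<in> cantor_stage n"
  proof (induction n arbitrary: b)
    case 0
    then show ?case
      using digit_series_bounds[of "1/3" b] by (simp add: cantor_point_def)
  next
    case (Suc n)
    have "cantor_point b = (cantor_point (\<lambda>k. b (Suc k)) + 2 * of_bool (b 0)) / 3"
      using digit_series_unfold[of "1/3" b] by (simp add: cantor_point_def)
    then show ?case
      using Suc.IH[of "\<lambda>k. b (Suc k)"] by (cases "b 0") auto
  qed
qed

lemma cantor_point_surj:
  assumes "x \<in> cantor_set"
  obtains b where "cantor_point b = x"
proof -
  have range01: "0 \<le> y \<and> y \<le> 1" if "y \<in> cantor_set" for y
    using that unfolding cantor_set_def by (auto dest!: spec[of _ 0])
  obtain b where "digit_series (1/3) b = 3/2 * x"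
  proof (rule digit_expansion_exists[where X = "(\<lambda>y. 3/2 * y) ` cantor_set" and r = "1/3" and M = "3/2" and x = "3/2 * x"])
    fix z :: real assume "z \<in> (\<lambda>y. 3/2 * y) ` cantor_set"
    then obtain y where y: "y \<in> cantor_set" "z = 3/2 * y" by auto
    then obtain d where "3 * y - 2 * of_bool d \<in> cantor_set"
      using cantor_set_digit by blast
    then show "\<exists>d. (z - of_bool d) / (1/3) \<in> (\<lambda>y. 3/2 * y) ` cantor_set"
      by (intro exI[of _ d] image_eqI[where x = "3 * y - 2 * of_bool d"]) (auto simp: y)
  next
    fix z :: real assume "z \<in> (\<lambda>y. 3/2 * y) ` cantor_set"
    then show "\<bar>z\<bar> \<le> 3/2"
      using range01 by (auto simp: abs_mult)
  qed (use assms in auto)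
  then show ?thesis
    using that[of b] by (simp add: cantor_point_def)
qed

lemma cantor_point_inj: "cantor_point b = cantor_point c \<longleftrightarrow> b = c"
  by (auto simp: cantor_point_def dest: digit_series_third_inj)

lemma continuous_on_digit_series:
  assumes "0 \<le> r" "r < 1"
  shows "continuous_on UNIV (\<lambda>s :: 'i \<Rightarrow> bool. digit_series r (\<lambda>k. s (e k)))"
proof -
  have "uniform_limit UNIV (\<lambda>n (s :: 'i \<Rightarrow> bool). \<Sum>k<n. of_bool (s (e k)) * r ^ k)
      (\<lambda>s. \<Sum>k. of_bool (s (e k)) * r ^ k) sequentially"
    by (rule Weierstrass_m_test[where M = "\<lambda>k. r ^ k"])
       (use assms in \<open>auto intro!: summable_geometric\<close>)
  moreover have "continuous_on UNIV (\<lambda>s :: 'i \<Rightarrow> bool. of_bool (s i) :: real)" for i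
    by (rule continuous_on_compose2[OF _ continuous_on_product_coordinates[of i], where t = UNIV]) auto
  then have "continuous_on UNIV (\<lambda>s :: 'i \<Rightarrow> bool. \<Sum>k<n. of_bool (s (e k)) * r ^ k)" for n
    by (intro continuous_intros) auto
  ultimately show ?thesis
    unfolding digit_series_def by (intro uniform_limit_theorem) auto
qed

section \<open>A skew product over the shift\<close>

type_synonym config = "int \<times> nat \<Rightarrow> bool"

definition shift :: "int \<Rightarrow> config \<Rightarrow> config" where
  "shift n s = (\<lambda>(i, j). s (i + n, j))"

definition drift :: "int \<Rightarrow> config \<Rightarrow> real" where
  "drift i s = digit_series (1/2) (\<lambda>j. s (i, j)) - 1"

text \<open>Sums of drifts along the orbit of \<open>s\<close>: the cocycle of the skew product over the shift.\<close>

definition total_drift :: "nat \<Rightarrow> config \<Rightarrow> real" where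
  "total_drift n s = (\<Sum>i<n. drift (int i) s)"

definition skew :: "config \<times> real \<Rightarrow> config \<times> real" where
  "skew = (\<lambda>(s, t). (shift 1 s, t powr exp (drift 0 s)))"

text \<open>The inverse undoes the last step, and after \<open>shift 1\<close> the letter that drove it is at position
  \<open>-1\<close>.\<close>

definition skew_inv :: "config \<times> real \<Rightarrow> config \<times> real" where
  "skew_inv = (\<lambda>(s, t). (shift (-1) s, t powr exp (- drift (-1) s)))"

definition cylinder_space :: "(config \<times> real) set" where
  "cylinder_space = UNIV \<times> {0..1}"

lemma shift_apply [simp]: "shift n s (i, j) = s (i + n, j)"
  by (simp add: shift_def)

lemma shift_shift: "shift m (shift n s) = shift (m + n) s"
  by (auto simp: shift_def fun_eq_iff add_ac)

lemma shift_zero [simp]: "shift 0 s = s"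
  by (auto simp: shift_def)

lemma drift_shift: "drift i (shift n s) = drift (i + n) s"
  by (simp add: drift_def)

lemma drift_cong: "(\<And>j. s (i, j) = s' (i', j)) \<Longrightarrow> drift i s = drift i' s'"
  by (simp add: drift_def)

lemma continuous_on_drift: "continuous_on UNIV (drift i)"
  unfolding drift_def by (intro continuous_intros continuous_on_digit_series) auto

lemma continuous_on_shift: "continuous_on UNIV (shift n)"
proof (rule continuous_on_coordinatewise_then_product)
  fix ij :: "int \<times> nat"
  have "(\<lambda>s. shift n s ij) = (\<lambda>s. s (fst ij + n, snd ij))"
    by (simp add: shift_def case_prod_beta)
  then show "continuous_on UNIV (\<lambda>s. shift n s ij)"
    by (simp only: continuous_on_product_coordinates)
qed

lemma continuous_on_skew_step:
  assumes "continuous_on UNIV d"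
  shows "continuous_on cylinder_space (\<lambda>(s, t). (shift n s, t powr exp (d s)))"
  unfolding case_prod_beta cylinder_space_def
  by (intro continuous_on_Pair continuous_on_powr' continuous_intros
        continuous_on_compose2[OF continuous_on_shift] continuous_on_compose2[OF assms]) auto

lemma continuous_on_skew: "continuous_on cylinder_space skew"
  unfolding skew_def by (intro continuous_on_skew_step continuous_on_drift)

lemma continuous_on_skew_inv: "continuous_on cylinder_space skew_inv"
  unfolding skew_inv_def by (intro continuous_on_skew_step continuous_intros continuous_on_drift)

lemma unit_powr_exp_in: "0 \<le> t \<Longrightarrow> t \<le> 1 \<Longrightarrow> t powr exp v \<le> (1::real)"
  by (rule powr_le1) auto

lemma skew_in: "skew \<in> cylinder_space \<rightarrow> cylinder_space"
  by (auto simp: skew_def cylinder_space_def unit_powr_exp_in)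

lemma skew_inv_in: "skew_inv \<in> cylinder_space \<rightarrow> cylinder_space"
  by (auto simp: skew_inv_def cylinder_space_def unit_powr_exp_in)

lemma skew_inverses:
  assumes "x \<in> cylinder_space"
  shows "skew (skew_inv x) = x" "skew_inv (skew x) = x"
  using assms
  by (auto simp: skew_def skew_inv_def cylinder_space_def shift_shift drift_shift powr_powr
      simp flip: exp_add)

lemma skew_iterate:
  assumes "0 \<le> t"
  shows "(skew ^^ n) (s, t) = (shift (int n) s, t powr exp (total_drift n s))"
proof (induction n)
  case 0
  then show ?case using assms by (simp add: total_drift_def)
next
  case (Suc n)
  then show ?case
    by (simp add: skew_def shift_shift drift_shift powr_powr total_drift_def exp_add)
qed

lemma compact_cylinder_space: "compact cylinder_space"
proof -
  have "compact_space (product_topology (\<lambda>_. euclidean) UNIV :: config topology)"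
    unfolding compact_space_product_topology
    by (auto simp: compact_space_def finite_imp_compact)
  then have "compact (UNIV :: config set)"
    by (simp add: euclidean_product_topology compact_space_def)
  then show ?thesis
    unfolding cylinder_space_def by (intro compact_Times) auto
qed

section \<open>Mixing and dense periodic points upstairs\<close>

definition agree :: "nat \<Rightarrow> config \<Rightarrow> config \<Rightarrow> bool" where
  "agree m s s' \<longleftrightarrow> (\<forall>i j. \<bar>i\<bar> \<le> int m \<longrightarrow> s' (i, j) = s (i, j))"

lemma open_config_contains_agree:
  assumes "open U" "s \<in> U"
  obtains m where "\<And>s'. agree m s s' \<Longrightarrow> s' \<in> U"
proof -
  have "openin (product_topology (\<lambda>_. euclidean) UNIV) U"
    using assms by (simp add: euclidean_product_topology)
  from product_topology_open_contains_basis[OF this assms(2)]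
  obtain X where X: "s \<in> (\<Pi>\<^sub>E i\<in>UNIV. X i)" "finite {i. X i \<noteq> (UNIV :: bool set)}"
    "(\<Pi>\<^sub>E i\<in>UNIV. X i) \<subseteq> U"
    by auto
  define m where "m = (\<Sum>ij \<in> {ij. X ij \<noteq> UNIV}. nat \<bar>fst ij\<bar>)"
  have "nat \<bar>fst ij\<bar> \<le> m" if "X ij \<noteq> UNIV" for ij
    unfolding m_def by (rule member_le_sum) (use X that in auto)
  then have m: "\<bar>i\<bar> \<le> int m" if "X (i, j) \<noteq> UNIV" for i j
    using that by (metis fst_conv nat_le_iff)
  show ?thesis
  proof (rule that)
    fix s' assume "agree m s s'"
    then have "s' (i, j) \<in> X (i, j)" for i j
      using X(1) m[of i j] by (cases "X (i, j) = UNIV") (auto simp: agree_def)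
    then show "s' \<in> U"
      using X(3) by auto
  qed
qed

text \<open>Heights \<open>0\<close> and \<open>1\<close> are fixed by the dynamics, so the point is chosen at an interior height. Only
  the word needs to be varied afterwards, because heights will be hit exactly.\<close>

lemma open_cylinder_contains_agree:
  assumes "openin (top_of_set cylinder_space) U" "U \<noteq> {}"
  obtains s t m where "0 < t" "t < 1" "\<And>s'. agree m s s' \<Longrightarrow> (s', t) \<in> U"
proof -
  obtain W where W: "open W" "U = cylinder_space \<inter> W"
    using assms(1) unfolding openin_open by blast
  then obtain s t0 where st0: "(s, t0) \<in> W" "0 \<le> t0" "t0 \<le> 1"
    using assms(2) unfolding cylinder_space_def by fastforce
  have "open (Pair s -` W)"
    by (intro open_vimage W continuous_intros)
  moreover have "t0 \<in> closure {0<..<1}" "t0 \<in> Pair s -` W"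
    using st0 by auto
  ultimately obtain t where t: "t \<in> {0<..<1}" "(s, t) \<in> W"
    by (metis disjoint_iff open_Int_closure_eq_empty vimage_eq)
  have "open ((\<lambda>s'. (s', t)) -` W)"
    by (intro open_vimage W continuous_intros)
  with t obtain m where "\<And>s'. agree m s s' \<Longrightarrow> (s', t) \<in> W"
    using open_config_contains_agree[of "(\<lambda>s'. (s', t)) -` W" s] by auto
  with t show ?thesis
    by (intro that[of t m s]) (auto simp: W cylinder_space_def)
qed

lemma total_drift_add: "total_drift (m + n) s = total_drift m s + total_drift n (shift (int m) s)"
  by (induction n) (simp_all add: total_drift_def drift_shift add_ac)

lemma total_drift_cong:
  "(\<And>i j. i < n \<Longrightarrow> s (int i, j) = s' (int i, j)) \<Longrightarrow> total_drift n s = total_drift n s'"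
  unfolding total_drift_def by (intro sum.cong drift_cong) auto

text \<open>The word \<open>u\<close> follows \<open>s\<close> up to position \<open>m\<close> and the translate of \<open>s'\<close> from position \<open>n - m\<close> on.
  The letters between them are all equal, and their common drift is the missing amount \<open>v - A\<close> divided
  by the length \<open>k\<close> of the gap; it is an admissible drift as soon as \<open>k \<ge> \<bar>v - A\<bar>\<close>.\<close>

lemma config_with_prescribed_drift:
  obtains n0 where "\<And>n. n \<ge> n0 \<Longrightarrow>
    \<exists>u. agree m s u \<and> agree m s' (shift (int n) u) \<and> total_drift n u = v"
proof -
  \<comment> \<open>\<open>A\<close> is the drift picked up outside the gap, from positions \<open>0..m\<close> of \<open>s\<close> and \<open>-m..-1\<close> of \<open>s'\<close>.\<close>
  define A where "A = total_drift (m + 1) s + total_drift m (shift (- int m) s')"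
  have fill: "\<exists>u. agree m s u \<and> agree m s' (shift (int (m + 1 + k + m)) u)
      \<and> total_drift (m + 1 + k + m) u = v" if k: "0 < k" "\<bar>v - A\<bar> \<le> real k" for k
  proof -
    have "\<bar>(v - A) / real k\<bar> \<le> 1"
      using k by simp
    then have "0 \<le> (v - A) / real k + 1" "(v - A) / real k + 1 \<le> 2"
      by linarith+
    then obtain a where a: "digit_series (1/2) a = (v - A) / real k + 1"
      by (rule digit_series_half_surj)
    define u :: config where "u = (\<lambda>(i, j). if i \<le> int m then s (i, j)
      else if i \<le> int (m + k) then a j else s' (i - int (m + 1 + k + m), j))"
    have "total_drift (m + 1 + k + m) u = total_drift (m + 1) u
        + total_drift k (shift (int (m + 1)) u) + total_drift m (shift (int (m + 1 + k)) u)"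
      by (simp only: total_drift_add)
    also have "total_drift (m + 1) u = total_drift (m + 1) s"
      by (rule total_drift_cong) (auto simp: u_def)
    also have "total_drift k (shift (int (m + 1)) u) = (\<Sum>i<k. (v - A) / real k)"
      unfolding total_drift_def
    proof (rule sum.cong)
      fix i assume "i \<in> {..<k}"
      then have "(\<lambda>j. shift (int (m + 1)) u (int i, j)) = a"
        by (auto simp: u_def)
      then show "drift (int i) (shift (int (m + 1)) u) = (v - A) / real k"
        by (simp only: drift_def a)
    qed auto
    also have "total_drift m (shift (int (m + 1 + k)) u) = total_drift m (shift (- int m) s')"
      by (rule total_drift_cong) (auto simp: u_def algebra_simps)
    finally have "total_drift (m + 1 + k + m) u = v"
      using k by (simp add: A_def)
    moreover have "agree m s u" "agree m s' (shift (int (m + 1 + k + m)) u)"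
      by (auto simp: agree_def u_def)
    ultimately show ?thesis by blast
  qed
  define k0 where "k0 = Suc (nat \<lceil>\<bar>v - A\<bar>\<rceil>)"
  show ?thesis
  proof (rule that)
    fix n assume n: "n \<ge> m + 1 + k0 + m"
    define k where "k = n - (m + 1 + m)"
    have "n = m + 1 + k + m" "k \<ge> k0"
      using n by (auto simp: k_def)
    moreover have "\<bar>v - A\<bar> \<le> real k0" "0 < k0"
      unfolding k0_def by linarith+
    ultimately show "\<exists>u. agree m s u \<and> agree m s' (shift (int n) u) \<and> total_drift n u = v"
      using fill[of k] by auto
  qed
qed

text \<open>In the coordinate \<open>ln (- ln t)\<close> on \<open>(0,1)\<close> the map \<open>t \<mapsto> t powr exp v\<close> is translation by \<open>v\<close>.\<close>

lemma unit_powr_transitive: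
  assumes "0 < t" "t < 1" "0 < t'" "t' < (1::real)"
  obtains v where "t powr exp v = t'"
proof
  have "0 < ln t' / ln t"
    using assms by (simp add: divide_neg_neg)
  then show "t powr exp (ln (ln t' / ln t)) = t'"
    using assms by (simp add: powr_def)
qed

lemma agree_mono: "agree m s s' \<Longrightarrow> m' \<le> m \<Longrightarrow> agree m' s s'"
  by (force simp: agree_def)

text \<open>The two cylinders may fix words on windows of different sizes; both use the larger window. Then
  \<open>v\<close> is the translation that takes the height in \<open>U\<close> to the one in \<open>V\<close>.\<close>

lemma skew_mixing:
  assumes U: "openin (top_of_set cylinder_space) U" "U \<noteq> {}"
    and V: "openin (top_of_set cylinder_space) V" "V \<noteq> {}"
  shows "\<exists>n0. \<forall>n\<ge>n0. (skew ^^ n) ` U \<inter> V \<noteq> {}"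
proof -
  obtain s t m where st: "0 < t" "t < 1" "\<And>u. agree m s u \<Longrightarrow> (u, t) \<in> U"
    using open_cylinder_contains_agree[OF U] by metis
  obtain s' t' m' where st': "0 < t'" "t' < 1" "\<And>u. agree m' s' u \<Longrightarrow> (u, t') \<in> V"
    using open_cylinder_contains_agree[OF V] by metis
  obtain v where v: "t powr exp v = t'"
    using unit_powr_transitive st st' by metis
  obtain n0 where n0: "\<And>n. n \<ge> n0 \<Longrightarrow> \<exists>u. agree (max m m') s u \<and>
      agree (max m m') s' (shift (int n) u) \<and> total_drift n u = v"
    using config_with_prescribed_drift by blast
  have "(skew ^^ n) ` U \<inter> V \<noteq> {}" if "n \<ge> n0" for n
  proof -
    obtain u where u: "agree (max m m') s u" "agree (max m m') s' (shift (int n) u)"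
      "total_drift n u = v"
      using n0[OF \<open>n \<ge> n0\<close>] by blast
    have "(u, t) \<in> U" "(shift (int n) u, t') \<in> V"
      using u by (auto intro!: st st' elim: agree_mono)
    moreover have "(skew ^^ n) (u, t) = (shift (int n) u, t')"
      using st u v by (simp add: skew_iterate)
    ultimately show ?thesis
      by (metis IntI empty_iff imageI)
  qed
  then show ?thesis by blast
qed

text \<open>The window \<open>[-m, m]\<close> of \<open>s\<close>, of length \<open>L = 2 m + 1\<close>, is continued antiperiodically: a translation
  by \<open>L\<close> complements every bit. Drifts at distance \<open>L\<close> then cancel, and \<open>2 L\<close> is a period.\<close>

lemma skew_dense_periodic:
  assumes "openin (top_of_set cylinder_space) U" "U \<noteq> {}"
  shows "\<exists>x\<in>U. \<exists>n>0. (skew ^^ n) x = x"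
proof -
  obtain s t m where st: "0 < t" "t < 1" "\<And>u. agree m s u \<Longrightarrow> (u, t) \<in> U"
    using open_cylinder_contains_agree[OF assms] by metis
  define L where "L = 2 * m + 1"
  define u :: config where
    "u = (\<lambda>(i, j). s ((i + int m) mod int L - int m, j) = even ((i + int m) div int L))"
  have "u (i, j) = s (i, j)" if "\<bar>i\<bar> \<le> int m" for i j
  proof -
    have "0 \<le> i + int m" "i + int m < int L"
      using that by (auto simp: L_def)
    then show ?thesis by (simp add: u_def)
  qed
  then have "agree m s u"
    by (simp add: agree_def)
  have anti: "u (i + int L, j) = (\<not> u (i, j))" for i j
  proof -
    have "i + int L + int m = (i + int m) + int L"
      by simp
    then have "(i + int L + int m) mod int L = (i + int m) mod int L"
      by (simp only: mod_add_self2)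
    moreover have "(i + int L + int m) div int L = (i + int m) div int L + 1"
      unfolding \<open>i + int L + int m = (i + int m) + int L\<close>
      by (rule div_add_self2) (simp add: L_def)
    ultimately show ?thesis
      unfolding u_def by simp
  qed
  have "drift (i + int L) u = - drift i u" for i
    by (simp add: drift_def anti digit_series_complement)
  then have "total_drift L (shift (int L) u) = - total_drift L u"
    by (simp add: total_drift_def drift_shift sum_negf)
  then have "total_drift (L + L) u = 0"
    by (simp only: total_drift_add)
  moreover have "shift (int (L + L)) u = u"
  proof
    fix ij :: "int \<times> nat"
    obtain i j where "ij = (i, j)" by fastforce
    then show "shift (int (L + L)) u ij = u ij"
      using anti[of "i + int L" j] anti[of i j] by (simp add: add.assoc)
  qed
  ultimately have "(skew ^^ (L + L)) (u, t) = (u, t)"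
    using st by (simp add: skew_iterate del: of_nat_add)
  moreover have "L + L > 0"
    by (simp add: L_def)
  ultimately show ?thesis
    using st(3)[OF \<open>agree m s u\<close>] by blast
qed

section \<open>Passing to a quotient\<close>

text \<open>A continuous map from a compact space onto a metric space is closed, hence a quotient map; so a
  map that respects its fibres descends to a continuous one.\<close>

lemma induced_map:
  fixes p :: "'b::topological_space \<Rightarrow> 'a::metric_space"
  assumes X: "compact X" and p: "continuous_on X p" "p ` X = C"
    and T: "continuous_on X T" "T \<in> X \<rightarrow> X"
    and compat: "\<And>x y. x \<in> X \<Longrightarrow> y \<in> X \<Longrightarrow> p x = p y \<Longrightarrow> p (T x) = p (T y)"
  obtains f where "continuous_on C f" "f \<in> C \<rightarrow> C" "\<And>x. x \<in> X \<Longrightarrow> f (p x) = p (T x)"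
proof -
  define f where "f = (\<lambda>y. p (T (inv_into X p y)))"
  have f: "f (p x) = p (T x)" if "x \<in> X" for x
    unfolding f_def using that
    by (intro compat) (auto intro: inv_into_into simp: f_inv_into_f)
  have "compact C"
    using X p compact_continuous_image by blast
  have "continuous_on C f"
    unfolding continuous_on_closed_vimage[OF compact_imp_closed[OF \<open>compact C\<close>]]
  proof (intro allI impI)
    fix B :: "'a set" assume B: "closed B"
    have "continuous_on X (\<lambda>x. p (T x))"
      using T by (intro continuous_on_compose2[OF p(1) T(1)]) auto
    then have "closedin (top_of_set X) (X \<inter> (\<lambda>x. p (T x)) -` B)"
      using B continuous_closedin_preimage by blast
    then have "compact (X \<inter> (\<lambda>x. p (T x)) -` B)"
      using X closedin_compact by blast
    then have "compact (p ` (X \<inter> (\<lambda>x. p (T x)) -` B))"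
      using p(1) by (intro compact_continuous_image) (auto intro: continuous_on_subset)
    moreover have "f -` B \<inter> C = p ` (X \<inter> (\<lambda>x. p (T x)) -` B)"
      using f p(2) by (auto 0 3)
    ultimately show "closed (f -` B \<inter> C)"
      by (simp add: compact_imp_closed)
  qed
  moreover have "f \<in> C \<rightarrow> C"
    using f T p(2) by auto
  ultimately show ?thesis
    using f that by blast
qed

lemma chaos_passes_to_factor:
  fixes p :: "'b::topological_space \<Rightarrow> 'a::metric_space"
  assumes X: "compact X" "X \<noteq> {}" and p: "continuous_on X p" "p ` X = C" and T: "T \<in> X \<rightarrow> X"
    and f: "continuous_on C f" "f \<in> C \<rightarrow> C" "\<And>x. x \<in> X \<Longrightarrow> f (p x) = p (T x)"
    and mix: "\<And>U V. \<lbrakk>openin (top_of_set X) U; U \<noteq> {}; openin (top_of_set X) V; V \<noteq> {}\<rbrakk>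
        \<Longrightarrow> \<exists>n0. \<forall>n\<ge>n0. (T ^^ n) ` U \<inter> V \<noteq> {}"
    and per: "\<And>U. \<lbrakk>openin (top_of_set X) U; U \<noteq> {}\<rbrakk> \<Longrightarrow> \<exists>x\<in>U. \<exists>n>0. (T ^^ n) x = x"
  shows "dynamical_system C f" "mixing_on C f" "devaney_chaotic_on C f"
proof -
  have iter: "(T ^^ n) x \<in> X \<and> (f ^^ n) (p x) = p ((T ^^ n) x)" if "x \<in> X" for x n
    by (induction n) (use that T f in auto)
  have pull: "openin (top_of_set X) (X \<inter> p -` U) \<and> X \<inter> p -` U \<noteq> {}"
    if "openin (top_of_set C) U" "U \<noteq> {}" for U
  proof
    show "openin (top_of_set X) (X \<inter> p -` U)"
      using p that(1) by (intro continuous_openin_preimage[of X p C]) auto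
    show "X \<inter> p -` U \<noteq> {}"
      using that p(2) openin_imp_subset by fastforce
  qed
  show "dynamical_system C f"
    unfolding dynamical_system_def
    using X p f compact_continuous_image by auto
  show mixing: "mixing_on C f"
    unfolding mixing_on_def
  proof (intro allI impI, elim conjE)
    fix U V assume "openin (top_of_set C) U" "U \<noteq> {}" "openin (top_of_set C) V" "V \<noteq> {}"
    then obtain n0 where n0: "\<And>n. n \<ge> n0 \<Longrightarrow> (T ^^ n) ` (X \<inter> p -` U) \<inter> (X \<inter> p -` V) \<noteq> {}"
      using mix[of "X \<inter> p -` U" "X \<inter> p -` V"] pull by meson
    have "(f ^^ n) ` U \<inter> V \<noteq> {}" if "n \<ge> n0" for n
    proof -
      obtain x where "x \<in> X" "p x \<in> U" "p ((T ^^ n) x) \<in> V"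
        using n0[OF \<open>n \<ge> n0\<close>] by auto
      then show ?thesis
        using iter[of x n] by (metis IntI empty_iff imageI)
    qed
    then show "\<exists>n0. \<forall>n>0. n \<ge> n0 \<longrightarrow> (f ^^ n) ` U \<inter> V \<noteq> {}"
      by blast
  qed
  have "transitive_on C f"
    unfolding transitive_on_def
  proof (intro allI impI)
    fix U V
    assume "openin (top_of_set C) U \<and> U \<noteq> {} \<and> openin (top_of_set C) V \<and> V \<noteq> {}"
    then obtain n0 where "\<And>n. n > 0 \<Longrightarrow> n \<ge> n0 \<Longrightarrow> (f ^^ n) ` U \<inter> V \<noteq> {}"
      using mixing unfolding mixing_on_def by meson
    then have "(f ^^ Suc n0) ` U \<inter> V \<noteq> {}"
      by (meson le_SucI order_refl zero_less_Suc)
    then show "\<exists>n. (f ^^ n) ` U \<inter> V \<noteq> {}"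
      by blast
  qed
  moreover have "C \<subseteq> closure (periodic_points C f)"
  proof
    fix y assume y: "y \<in> C"
    show "y \<in> closure (periodic_points C f)"
      unfolding closure_iff_nhds_not_empty
    proof (intro allI impI)
      fix A W assume W: "W \<subseteq> A" "open W" "y \<in> W"
      have "openin (top_of_set C) (C \<inter> W)" "C \<inter> W \<noteq> {}"
        using W y by auto
      from per[of "X \<inter> p -` (C \<inter> W)"] pull[OF this]
      obtain x n where x: "x \<in> X" "p x \<in> C \<inter> W" "n > 0" "(T ^^ n) x = x"
        by auto
      then have "p x \<in> periodic_points C f"
        using iter[of x n] by (auto simp: periodic_points_def)
      then show "periodic_points C f \<inter> A \<noteq> {}"
        using x W by auto
    qed
  qed
  ultimately show "devaney_chaotic_on C f"
    by (simp add: devaney_chaotic_on_def)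
qed

section \<open>The Cantor fan as a quotient\<close>

text \<open>The enumeration \<open>e\<close> selects the bits of a word that determine the blade of the fan.\<close>

definition fan_map :: "(nat \<Rightarrow> int \<times> nat) \<Rightarrow> config \<times> real \<Rightarrow> real \<times> real" where
  "fan_map e = (\<lambda>(s, t). (t * cantor_point (s \<circ> e), t))"

lemma continuous_on_fan_map: "continuous_on A (fan_map e)"
proof -
  have "continuous_on UNIV (\<lambda>s :: config. cantor_point (s \<circ> e))"
    unfolding cantor_point_def comp_def by (intro continuous_intros continuous_on_digit_series) auto
  then show ?thesis
    unfolding fan_map_def case_prod_beta
    by (intro continuous_intros continuous_on_compose2[where g = "\<lambda>s. cantor_point (s \<circ> e)" and f = fst]) auto
qed

lemma fan_map_eq_iff:
  "fan_map e (s, t) = fan_map e (s', t') \<longleftrightarrow> t = t' \<and> (t = 0 \<or> s \<circ> e = s' \<circ> e)"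
  by (auto simp: fan_map_def cantor_point_inj)

text \<open>Injectivity of \<open>e\<close> allows the bits at the positions \<open>e k\<close> to be prescribed independently.\<close>

lemma fan_map_image:
  assumes "inj e"
  shows "fan_map e ` cylinder_space = standard_cantor_fan"
proof -
  have segment: "closed_segment (0, 0) (c, 1) = (\<lambda>t. (t * c, t)) ` {0..1}" for c :: real
    by (auto simp: closed_segment_def image_iff)
  have "\<exists>s. cantor_point (s \<circ> e) = c" if "c \<in> cantor_set" for c
  proof -
    obtain b where "cantor_point b = c"
      using cantor_point_surj[OF \<open>c \<in> cantor_set\<close>] by blast
    then show ?thesis
      using assms by (intro exI[of _ "b \<circ> inv e"]) (simp add: o_assoc[symmetric])
  qed
  then have "cantor_set = range (\<lambda>s. cantor_point (s \<circ> e))"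
    using cantor_point_in by (auto simp: image_iff)
  then show ?thesis
    unfolding standard_cantor_fan_def segment \<open>cantor_set = _\<close>
    by (auto simp: fan_map_def cylinder_space_def image_iff)
qed

text \<open>Words that the enumeration \<open>e\<close> cannot distinguish must have the same drift and indistinguishable
  shifts; the vertex, where \<open>fan_map e\<close> forgets the word altogether, is harmless because height \<open>0\<close>
  stays \<open>0\<close>.\<close>

lemma fan_map_skew_compat:
  assumes closed: "\<And>s s' :: config. s \<circ> e = s' \<circ> e \<Longrightarrow>
      shift n s \<circ> e = shift n s' \<circ> e \<and> d s = d s'"
    and T: "T = (\<lambda>(s, t). (shift n s, t powr exp (d s)))"
    and eq: "fan_map e x = fan_map e y"
  shows "fan_map e (T x) = fan_map e (T y)"
proof -
  obtain s t s' t' where xy: "x = (s, t)" "y = (s', t')" by fastforce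
  show ?thesis
  proof (cases "t = 0")
    case True
    then show ?thesis using eq by (simp add: xy T fan_map_eq_iff)
  next
    case False
    then show ?thesis using eq closed[of s s'] by (auto simp: xy T fan_map_eq_iff)
  qed
qed

text \<open>This enumeration covers exactly the positions \<open>i \<ge> 0\<close>. It keeps what the skew product needs to
  know about a word, and the shift loses the letter at position \<open>0\<close>.\<close>

definition enum_future :: "nat \<Rightarrow> int \<times> nat" where
  "enum_future k = (int (fst (prod_decode k)), snd (prod_decode k))"

lemma inj_enum_future: "inj enum_future"
  by (rule injI) (metis Pair_inject enum_future_def injD inj_prod_decode of_nat_eq_iff prod.expand)

lemma comp_enum_future_eq_iff:
  "s \<circ> enum_future = s' \<circ> enum_future \<longleftrightarrow> (\<forall>i\<ge>0. \<forall>j. s (i, j) = s' (i, j))"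
proof
  assume eq: "s \<circ> enum_future = s' \<circ> enum_future"
  show "\<forall>i\<ge>0. \<forall>j. s (i, j) = s' (i, j)"
  proof (intro allI impI)
    fix i :: int and j :: nat assume "0 \<le> i"
    then have "(i, j) = enum_future (prod_encode (nat i, j))"
      by (simp add: enum_future_def)
    then show "s (i, j) = s' (i, j)"
      using eq by (metis comp_apply)
  qed
qed (auto simp: enum_future_def fun_eq_iff)

lemma obtain_enumeration:
  obtains e :: "nat \<Rightarrow> int \<times> nat" where "bij e"
  using that[of "from_nat_into UNIV"] bij_betw_from_nat_into[of "UNIV :: (int \<times> nat) set"]
  by (auto simp: finite_prod)

theorem theorem5p13:
  fixes C :: "'a::metric_space set"
  assumes "cantor_fan C"
  shows "(\<exists>f. dynamical_system C f \<and> \<not> (\<exists>g. homeomorphism C C f g) \<and>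
              mixing_on C f \<and> devaney_chaotic_on C f)
       \<and> (\<exists>h. dynamical_system C h \<and> (\<exists>g. homeomorphism C C h g) \<and>
              mixing_on C h \<and> devaney_chaotic_on C h)"
proof -
  obtain \<phi> \<psi> where hom: "homeomorphism standard_cantor_fan C \<phi> \<psi>"
    using assms unfolding cantor_fan_def by (meson homeomorphic_def homeomorphic_sym)
  define p where "p = (\<lambda>e x. \<phi> (fan_map e x))"
  have cont: "continuous_on cylinder_space (p e)" and img: "p e ` cylinder_space = C"
    if "inj e" for e
  proof -
    have "continuous_on standard_cantor_fan \<phi>" "\<phi> ` standard_cantor_fan = C"
      using hom by (auto simp: homeomorphism_def)
    then show "continuous_on cylinder_space (p e)" "p e ` cylinder_space = C"
      unfolding p_def using fan_map_image[OF that]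
      by (auto intro!: continuous_on_compose2[OF _ continuous_on_fan_map] simp flip: image_image)
  qed
  have eq: "p e x = p e y \<longleftrightarrow> fan_map e x = fan_map e y"
    if "inj e" "x \<in> cylinder_space" "y \<in> cylinder_space" for e x y
    using that fan_map_image[OF that(1)] hom unfolding p_def
    by (metis homeomorphism_apply1 imageI)
  have nonempty: "cylinder_space \<noteq> {}"
    by (auto simp: cylinder_space_def)
  have chaos: "dynamical_system C f \<and> mixing_on C f \<and> devaney_chaotic_on C f"
    if "inj e" "continuous_on C f" "f \<in> C \<rightarrow> C" "\<And>x. x \<in> cylinder_space \<Longrightarrow> f (p e x) = p e (skew x)"
    for e f
    using chaos_passes_to_factor[where X = cylinder_space and p = "p e" and T = skew and f = f, OF compact_cylinder_space nonempty cont[OF that(1)] img[OF that(1)]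
        skew_in that(2,3,4) skew_mixing skew_dense_periodic] by simp
  have induce: "\<exists>f. continuous_on C f \<and> f \<in> C \<rightarrow> C \<and> (\<forall>x\<in>cylinder_space. f (p e x) = p e (T x))"
    if e: "inj e" and T: "continuous_on cylinder_space T" "T \<in> cylinder_space \<rightarrow> cylinder_space"
      and compat: "\<And>x y. fan_map e x = fan_map e y \<Longrightarrow> fan_map e (T x) = fan_map e (T y)"
    for e T
  proof -
    have "p e (T x) = p e (T y)"
      if "x \<in> cylinder_space" "y \<in> cylinder_space" "p e x = p e y" for x y
      using compat[of x y] eq[OF e that(1,2)] that(3) by (simp add: p_def)
    then show ?thesis
      using induced_map[OF compact_cylinder_space cont[OF e] img[OF e] T] by metis
  qed
  show ?thesis
  proof
    let ?e = enum_future
    have "fan_map ?e (skew x) = fan_map ?e (skew y)" if "fan_map ?e x = fan_map ?e y" for x y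
      by (rule fan_map_skew_compat[OF _ skew_def that])
         (auto simp: comp_enum_future_eq_iff intro!: drift_cong)
    then obtain f where f: "continuous_on C f" "f \<in> C \<rightarrow> C"
      "\<And>x. x \<in> cylinder_space \<Longrightarrow> f (p ?e x) = p ?e (skew x)"
      using induce[OF inj_enum_future continuous_on_skew skew_in] by blast
    \<comment> \<open>Two words that differ only at position \<open>0\<close>, at the height \<open>1\<close> fixed by every drift.\<close>
    define x y :: "config \<times> real" where "x = ((\<lambda>_. False), 1)" and "y = ((\<lambda>(i, j). i = 0), 1)"
    have xy: "x \<in> cylinder_space" "y \<in> cylinder_space"
      by (auto simp: x_def y_def cylinder_space_def)
    have "f (p ?e x) = f (p ?e y)"
      using f(3)[OF xy(1)] f(3)[OF xy(2)]
      by (simp add: p_def x_def y_def skew_def fan_map_def comp_def enum_future_def shift_def)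
    moreover have "p ?e x \<noteq> p ?e y"
      unfolding eq[OF inj_enum_future xy] unfolding x_def y_def fan_map_eq_iff comp_enum_future_eq_iff
      by auto
    moreover have "p ?e x \<in> C" "p ?e y \<in> C"
      using xy img[OF inj_enum_future] by auto
    ultimately have "\<not> (\<exists>g. homeomorphism C C f g)"
      by (metis homeomorphism_apply1)
    then show "\<exists>f. dynamical_system C f \<and> \<not> (\<exists>g. homeomorphism C C f g) \<and>
        mixing_on C f \<and> devaney_chaotic_on C f"
      using chaos[OF inj_enum_future f] by blast
  next
    obtain e :: "nat \<Rightarrow> int \<times> nat" where "bij e"
      by (rule obtain_enumeration)
    then have e: "inj e" and comp_e: "s \<circ> e = s' \<circ> e \<longleftrightarrow> s = s'" for s s' :: config
      by (auto simp: bij_def) (metis comp_assoc comp_id surj_iff)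
    have "fan_map e (skew x) = fan_map e (skew y)" if "fan_map e x = fan_map e y" for x y
      by (rule fan_map_skew_compat[OF _ skew_def that]) (auto simp: comp_e)
    then obtain h where h: "continuous_on C h" "h \<in> C \<rightarrow> C"
      "\<And>x. x \<in> cylinder_space \<Longrightarrow> h (p e x) = p e (skew x)"
      using induce[OF e continuous_on_skew skew_in] by blast
    have "fan_map e (skew_inv x) = fan_map e (skew_inv y)" if "fan_map e x = fan_map e y" for x y
      by (rule fan_map_skew_compat[OF _ skew_inv_def that]) (auto simp: comp_e)
    then obtain g where g: "continuous_on C g" "g \<in> C \<rightarrow> C"
      "\<And>x. x \<in> cylinder_space \<Longrightarrow> g (p e x) = p e (skew_inv x)"
      using induce[OF e continuous_on_skew_inv skew_inv_in] by blast
    have "g (h y) = y \<and> h (g y) = y" if "y \<in> C" for y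
    proof -
      obtain x where "x \<in> cylinder_space" "y = p e x"
        using \<open>y \<in> C\<close> img[OF e] by blast
      then show ?thesis
        using h(3) g(3) skew_in skew_inv_in skew_inverses by (auto simp: Pi_iff)
    qed
    then have "homeomorphism C C h g"
      using h g by (intro homeomorphismI) auto
    then show "\<exists>h. dynamical_system C h \<and> (\<exists>g. homeomorphism C C h g) \<and>
        mixing_on C h \<and> devaney_chaotic_on C h"
      using chaos[OF e h] by blast
  qed
qed

end
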